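(* Let $\boldsymbol p=(p_1,p_2,\ldots)\in\mathbb{R}^{\mathbb{N}}$ be a probability distribution on $\mathbb{N}$ such that $\nu(\boldsymbol p)=\sum_{j\in\mathbb{N}}\sqrt{p_j}$ is finite. For $n\in\mathbb{N}$ let $X_1,\ldots,X_n$ be independent random variables, each distributed according to $\boldsymbol p$, and let $J_n=\sum_{j\in\mathbb{N}}\left|\hat p^{(n)}_j-p_j\right|$, where $\hat p^{(n)}_j$ is the empirical frequency of $j$. Then $$P\left(J_n>n^{-1/2}\,\nu(\boldsymbol p)+\varepsilon\right)\le\exp(-n\varepsilon^2/2)\qquad\text{for all }n\in\mathbb{N},\ \varepsilon>0.$$
   Context: $\mathbb{N}=\{1,2,\ldots\}$. A distribution $\boldsymbol p\in\mathbb{R}^{\mathbb{N}}$ is a sequence of nonnegative entries summing to $1$. The empirical frequencies are $\hat p^{(n)}_j=\frac1n\sum_{i=1}^n\mathbf 1_{\{X_i=j\}}$, $j\in\mathbb{N}$. The random variable $J_n$ is the $\ell_1$ distance between the empirical and the true distributions. *)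

theory Defs
  imports "HOL-Probability.Probability"
begin

text \<open>The paper's index set of positive integers is the set \<open>{1..}\<close> of type \<open>nat\<close>;
  the value \<open>p 0\<close> of a sequence is irrelevant.\<close>

definition distribution_on_pos :: "(nat \<Rightarrow> real) \<Rightarrow> bool" where
  "distribution_on_pos p \<longleftrightarrow> (\<forall>j\<in>{1..}. 0 \<le> p j) \<and> (p has_sum 1) {1..}"

text \<open>As \<open>infsum\<close> is \<open>0\<close> on families that are not summable, finiteness of \<open>nu p\<close> has to be
  assumed as summability.\<close>

definition nu :: "(nat \<Rightarrow> real) \<Rightarrow> real" where
  "nu p = (\<Sum>\<^sub>\<infinity>j\<in>{1..}. sqrt (p j))"

definition nu_finite :: "(nat \<Rightarrow> real) \<Rightarrow> bool" where
  "nu_finite p \<longleftrightarrow> (\<lambda>j. sqrt (p j)) summable_on {1..}"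

definition emp_freq :: "(nat \<Rightarrow> 'a \<Rightarrow> nat) \<Rightarrow> nat \<Rightarrow> nat \<Rightarrow> 'a \<Rightarrow> real" where
  "emp_freq X n j \<omega> = 1 / real n * (\<Sum>i=1..n. of_bool (X i \<omega> = j))"

text \<open>Whenever \<open>p\<close> is a distribution the family below is summable, being bounded by
  \<open>emp_freq X n j \<omega> + p j\<close>.\<close>

definition l1_dist :: "(nat \<Rightarrow> real) \<Rightarrow> (nat \<Rightarrow> 'a \<Rightarrow> nat) \<Rightarrow> nat \<Rightarrow> 'a \<Rightarrow> real" where
  "l1_dist p X n \<omega> = (\<Sum>\<^sub>\<infinity>j\<in>{1..}. \<bar>emp_freq X n j \<omega> - p j\<bar>)"

end

theory Submission
  imports Defs
begin

text \<open>By McDiarmid's bounded differences inequality, \<open>J\<^sub>n\<close> is concentrated around its mean: moving a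
  single sample changes the empirical frequencies by \<open>1 / n\<close> in at most two places, hence \<open>J\<^sub>n\<close> by at
  most \<open>2 / n\<close>. The mean is at most \<open>nu p / sqrt n\<close>, because the empirical frequency of \<open>j\<close> has
  variance at most \<open>p\<^sub>j / n\<close>, which by the Cauchy--Schwarz inequality bounds its mean deviation from
  \<open>p\<^sub>j\<close> by \<open>sqrt (p\<^sub>j / n)\<close>.\<close>

section \<open>McDiarmid's bounded differences inequality\<close>

text \<open>Integrating \<open>f\<close> over coordinate \<open>k\<close> gives a function \<open>h\<close> of the other coordinates with the same
  mean and bounded differences; Hoeffding's lemma in coordinate \<open>k\<close> controls \<open>f - h\<close>, and the
  induction hypothesis controls \<open>h\<close>.\<close>

lemma McDiarmid_nn_integral:
  fixes N :: "'i \<Rightarrow> 'b measure" and f :: "('i \<Rightarrow> 'b) \<Rightarrow> real"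
  assumes N: "\<And>i. prob_space (N i)" and "finite I" and "l > 0"
    and "f \<in> borel_measurable (PiM I N)"
    and "\<And>x. x \<in> space (PiM I N) \<Longrightarrow> \<bar>f x\<bar> \<le> B"
    and "\<And>x i y. x \<in> space (PiM I N) \<Longrightarrow> i \<in> I \<Longrightarrow> y \<in> space (N i) \<Longrightarrow> \<bar>f (x(i := y)) - f x\<bar> \<le> c i"
  shows "(\<integral>\<^sup>+x. exp (l * (f x - (\<integral>x. f x \<partial>PiM I N))) \<partial>PiM I N)
           \<le> ennreal (exp (l\<^sup>2 * (\<Sum>i\<in>I. (c i)\<^sup>2) / 8))"
  using assms(2,4-)
proof (induction I arbitrary: f rule: finite_induct)
  case empty
  show ?case
    by (simp add: PiM_empty nn_integral_count_space_finite lebesgue_integral_count_space_finite)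
next
  case (insert k I)
  interpret product_prob_space N I
    by (simp add: product_prob_space_def product_sigma_finite_def product_prob_space_axioms_def
        N prob_space_imp_sigma_finite)
  interpret insert: prob_space "PiM (insert k I) N"
    by (intro prob_space_PiM N)
  note [measurable] = insert.prems(1)
  have upd: "x(k := y) \<in> space (PiM (insert k I) N)"
    if "x \<in> space (PiM I N)" "y \<in> space (N k)" for x y
    using that by (auto simp: space_PiM PiE_def extensional_def)
  have bound: "\<bar>f (x(k := y))\<bar> \<le> B" if "x \<in> space (PiM I N)" "y \<in> space (N k)" for x y
    by (rule insert.prems(2)[OF upd[OF that]])
  have f_k [measurable]: "(\<lambda>y. f (x(k := y))) \<in> borel_measurable (N k)" if "x \<in> space (PiM I N)" for x
    using measurable_comp[OF measurable_component_update insert.prems(1), OF that insert.hyps(2)]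
    unfolding comp_def .
  have int_k: "integrable (N k) (\<lambda>y. f (x(k := y)))" if "x \<in> space (PiM I N)" for x
    by (rule M.integrable_const_bound[where B = B]) (use that bound in auto)
  define h where "h x = (\<integral>y. f (x(k := y)) \<partial>N k)" for x
  have [measurable]: "h \<in> borel_measurable (PiM I N)"
    unfolding h_def by measurable
  have h_bound: "\<bar>h x\<bar> \<le> B" if x: "x \<in> space (PiM I N)" for x
  proof -
    have "\<bar>h x\<bar> \<le> (\<integral>y. \<bar>f (x(k := y))\<bar> \<partial>N k)"
      unfolding h_def by (rule integral_abs_bound)
    also have "\<dots> \<le> (\<integral>y. B \<partial>N k)"
      using bound[OF x] int_k[OF x] by (intro integral_mono) auto
    finally show ?thesis by (simp add: M.prob_space)
  qed
  have h_diff: "\<bar>h (x(i := z)) - h x\<bar> \<le> c i"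
    if x: "x \<in> space (PiM I N)" and i: "i \<in> I" and z: "z \<in> space (N i)" for x i z
  proof -
    have xz: "x(i := z) \<in> space (PiM I N)"
      using that by (auto simp: space_PiM PiE_def extensional_def)
    \<comment> \<open>For distinct \<open>i\<close> and \<open>k\<close> the two updates commute, so
      for each fixed \<open>y\<close> the bounded difference of \<open>f\<close> in coordinate
      \<open>i\<close> applies under the integral.\<close>
    have ik: "i \<noteq> k" using i insert.hyps by auto
    have "\<bar>h (x(i := z)) - h x\<bar> = \<bar>\<integral>y. f ((x(i := z))(k := y)) - f (x(k := y)) \<partial>N k\<bar>"
      unfolding h_def using int_k[OF x] int_k[OF xz] by simp
    also have "\<dots> \<le> (\<integral>y. \<bar>f ((x(i := z))(k := y)) - f (x(k := y))\<bar> \<partial>N k)"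
      by (rule integral_abs_bound)
    also have "\<dots> \<le> (\<integral>y. c i \<partial>N k)"
    proof (rule integral_mono)
      fix y assume "y \<in> space (N k)"
      then show "\<bar>f ((x(i := z))(k := y)) - f (x(k := y))\<bar> \<le> c i"
        using insert.prems(3)[OF upd[OF x], of y i z] i z
        unfolding fun_upd_twist[OF ik] by (simp del: fun_upd_apply)
    qed (use int_k[OF x] int_k[OF xz] in auto)
    finally show ?thesis by (simp add: M.prob_space)
  qed
  have int_f: "integrable (PiM (insert k I) N) f"
    by (rule insert.integrable_const_bound[where B = B]) (use insert.prems in auto)
  define E where "E = (\<integral>x. f x \<partial>PiM (insert k I) N)"
  have E: "E = (\<integral>x. h x \<partial>PiM I N)"
    unfolding E_def h_def by (rule product_integral_insert[OF insert.hyps int_f])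
  have hoeffding: "(\<integral>\<^sup>+y. exp (l * (f (x(k := y)) - h x)) \<partial>N k) \<le> ennreal (exp (l\<^sup>2 * (c k)\<^sup>2 / 8))"
    if x: "x \<in> space (PiM I N)" for x
  proof -
    \<comment> \<open>Any two values of \<open>f (x(k := y))\<close> differ by at most
      \<open>c k\<close>, so they all lie in the interval of length \<open>c k\<close> that starts
      at their infimum. Their mean is \<open>h x\<close>, and Hoeffding's lemma applies.\<close>
    define a where "a = (INF y\<in>space (N k). f (x(k := y)))"
    have bdd: "bdd_below ((\<lambda>y. f (x(k := y))) ` space (N k))"
      using bound[OF x] by (intro bdd_belowI[where m = "-B"]) (force simp: abs_le_iff)
    interpret interval_bounded_random_variable "N k" "\<lambda>y. f (x(k := y))" a "a + c k"
    proof
      have "f (x(k := y)) \<in> {a..a + c k}" if y: "y \<in> space (N k)" for y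
      proof -
        have "f (x(k := y)) - c k \<le> a"
          unfolding a_def
        proof (rule cINF_greatest)
          fix z assume z: "z \<in> space (N k)"
          show "f (x(k := y)) - c k \<le> f (x(k := z))"
            using insert.prems(3)[OF upd[OF x z], of k y] y
            by (simp add: abs_le_iff del: fun_upd_apply)
        qed (simp add: M.not_empty)
        moreover have "a \<le> f (x(k := y))"
          unfolding a_def by (rule cINF_lower[OF bdd y])
        ultimately show ?thesis by simp
      qed
      then show "AE y in N k. f (x(k := y)) \<in> {a..a + c k}" by auto
    qed (use x in measurable)
    show ?thesis
      using Hoeffdings_lemma_nn_integral[OF \<open>l > 0\<close>] by (simp add: h_def)
  qed
  have "(\<integral>\<^sup>+x. exp (l * (f x - E)) \<partial>PiM (insert k I) N)
      = (\<integral>\<^sup>+x. (\<integral>\<^sup>+y. exp (l * (f (x(k := y)) - E)) \<partial>N k) \<partial>PiM I N)"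
    by (rule product_nn_integral_insert[OF insert.hyps]) measurable
  \<comment> \<open>Here \<open>f - E\<close> is split into \<open>h - E\<close> and
    \<open>f - h\<close>; the first part does not depend on \<open>y\<close> and leaves the inner
    integral.\<close>
  also have "\<dots> = (\<integral>\<^sup>+x. exp (l * (h x - E)) * (\<integral>\<^sup>+y. exp (l * (f (x(k := y)) - h x)) \<partial>N k) \<partial>PiM I N)"
  proof (rule nn_integral_cong)
    fix x assume x: "x \<in> space (PiM I N)"
    have "(\<integral>\<^sup>+y. exp (l * (f (x(k := y)) - E)) \<partial>N k)
        = (\<integral>\<^sup>+y. ennreal (exp (l * (h x - E))) * exp (l * (f (x(k := y)) - h x)) \<partial>N k)"
      by (intro nn_integral_cong) (simp add: algebra_simps flip: ennreal_mult exp_add)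
    also have "\<dots> = exp (l * (h x - E)) * (\<integral>\<^sup>+y. exp (l * (f (x(k := y)) - h x)) \<partial>N k)"
      by (rule nn_integral_cmult) (use x in measurable)
    finally show "(\<integral>\<^sup>+y. exp (l * (f (x(k := y)) - E)) \<partial>N k) = \<dots>" .
  qed
  also have "\<dots> \<le> (\<integral>\<^sup>+x. exp (l * (h x - E)) * ennreal (exp (l\<^sup>2 * (c k)\<^sup>2 / 8)) \<partial>PiM I N)"
    by (intro nn_integral_mono mult_left_mono hoeffding) auto
  also have "\<dots> = (\<integral>\<^sup>+x. exp (l * (h x - E)) \<partial>PiM I N) * ennreal (exp (l\<^sup>2 * (c k)\<^sup>2 / 8))"
    by (rule nn_integral_multc) measurable
  \<comment> \<open>By Fubini \<open>E\<close> is the mean of \<open>h\<close> as well as of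
    \<open>f\<close>, so the induction hypothesis for \<open>h\<close> fits.\<close>
  also have "\<dots> \<le> ennreal (exp (l\<^sup>2 * (\<Sum>i\<in>I. (c i)\<^sup>2) / 8)) * ennreal (exp (l\<^sup>2 * (c k)\<^sup>2 / 8))"
    unfolding E by (intro mult_right_mono insert.IH h_bound h_diff) auto
  also have "\<dots> = ennreal (exp (l\<^sup>2 * (\<Sum>i\<in>insert k I. (c i)\<^sup>2) / 8))"
    using insert.hyps by (simp add: algebra_simps add_divide_distrib flip: ennreal_mult exp_add)
  finally show ?case by (simp add: E_def)
qed

text \<open>Chernoff's method: Markov's inequality is applied to
  \<open>exp (l * (F \<omega> - expectation F))\<close>. Independence makes the joint law of the
  samples a product measure, so \<open>McDiarmid_nn_integral\<close> bounds the mean of this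
  exponential.\<close>

theorem (in prob_space) McDiarmid_ineq_ge:
  fixes f :: "('i \<Rightarrow> 'b) \<Rightarrow> real" and X :: "'i \<Rightarrow> 'a \<Rightarrow> 'b"
  assumes I: "finite I" "I \<noteq> {}" and indep: "indep_vars N X I"
    and f [measurable]: "f \<in> borel_measurable (PiM I N)"
    and f_bound: "\<And>x. x \<in> space (PiM I N) \<Longrightarrow> \<bar>f x\<bar> \<le> B"
    and f_diff: "\<And>x i y. x \<in> space (PiM I N) \<Longrightarrow> i \<in> I \<Longrightarrow> y \<in> space (N i) \<Longrightarrow> \<bar>f (x(i := y)) - f x\<bar> \<le> c i"
    and "\<epsilon> > 0" and c: "(\<Sum>i\<in>I. (c i)\<^sup>2) > 0"
  defines "F \<equiv> \<lambda>\<omega>. f (\<lambda>i\<in>I. X i \<omega>)"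
  shows "prob {\<omega> \<in> space M. F \<omega> \<ge> expectation F + \<epsilon>} \<le> exp (- 2 * \<epsilon>\<^sup>2 / (\<Sum>i\<in>I. (c i)\<^sup>2))"
proof -
  \<comment> \<open>\<open>McDiarmid_nn_integral\<close> asks for a probability space at every
    index; outside \<open>I\<close> a one-point space fills the gap.\<close>
  define D where "D i = (if i \<in> I then distr M (N i) (X i) else count_space {undefined})" for i
  have rv [measurable]: "random_variable (N i) (X i)" if "i \<in> I" for i
    using indep that by (auto simp: indep_vars_def)
  have D: "prob_space (D i)" for i
    using prob_space_distr[OF rv, of i] by (auto simp: D_def intro!: prob_spaceI)
  have sets_D: "sets (PiM I D) = sets (PiM I N)"
    by (intro sets_PiM_cong) (auto simp: D_def)
  have space_D: "space (PiM I D) = space (PiM I N)"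
    using sets_D by (rule sets_eq_imp_space_eq)
  have tuple [measurable]: "(\<lambda>\<omega>. \<lambda>i\<in>I. X i \<omega>) \<in> measurable M (PiM I N)"
    by (rule measurable_restrict) (rule rv)
  have "distr M (PiM I N) (\<lambda>\<omega>. \<lambda>i\<in>I. X i \<omega>) = PiM I (\<lambda>i. distr M (N i) (X i))"
    using indep_vars_iff_distr_eq_PiM'[where X = X, OF I(2) rv] indep by blast
  also have "\<dots> = PiM I D"
    by (intro PiM_cong) (auto simp: D_def)
  finally have distr: "distr M (PiM I N) (\<lambda>\<omega>. \<lambda>i\<in>I. X i \<omega>) = PiM I D" .
  have E: "(\<integral>x. f x \<partial>PiM I D) = expectation F"
    unfolding distr[symmetric] F_def by (rule integral_distr) measurable
  have [measurable]: "F \<in> borel_measurable M"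
    unfolding F_def by measurable

  define d where "d = (\<Sum>i\<in>I. (c i)\<^sup>2)"
  \<comment> \<open>This \<open>l\<close> minimises the exponent
    \<open>- l * \<epsilon> + l\<^sup>2 * d / 8\<close>; the minimum is
    \<open>- 2 * \<epsilon>\<^sup>2 / d\<close>.\<close>
  define l where "l = 4 * \<epsilon> / d"
  have l: "l > 0" using \<open>\<epsilon> > 0\<close> c by (simp add: l_def d_def)
  have "(\<integral>\<^sup>+\<omega>. exp (l * (F \<omega> - expectation F)) \<partial>M)
      = (\<integral>\<^sup>+x. exp (l * (f x - (\<integral>x. f x \<partial>PiM I D))) \<partial>PiM I D)"
    unfolding E unfolding distr[symmetric] by (subst nn_integral_distr) (auto simp: F_def)
  also have "\<dots> \<le> ennreal (exp (l\<^sup>2 * d / 8))"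
    unfolding d_def
  proof (rule McDiarmid_nn_integral[OF D I(1) l, where B = B])
    show "f \<in> borel_measurable (PiM I D)"
      using f measurable_cong_sets[OF sets_D refl] by blast
    show "\<bar>f (x(i := y)) - f x\<bar> \<le> c i"
      if "x \<in> space (PiM I D)" "i \<in> I" "y \<in> space (D i)" for x i y
      using that(3) by (intro f_diff that(2) that(1)[unfolded space_D]) (simp add: D_def that(2))
  qed (use f_bound space_D in auto)
  finally have mgf: "(\<integral>\<^sup>+\<omega>. exp (l * (F \<omega> - expectation F)) \<partial>M) \<le> ennreal (exp (l\<^sup>2 * d / 8))" .

  have "{\<omega> \<in> space M. F \<omega> \<ge> expectation F + \<epsilon>} = {\<omega> \<in> space M. F \<omega> - expectation F \<ge> \<epsilon>}"
    by (simp add: algebra_simps)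
  hence "ennreal (prob {\<omega> \<in> space M. F \<omega> \<ge> expectation F + \<epsilon>}) = emeasure M \<dots>"
    by (simp add: emeasure_eq_measure)
  also have "\<dots> \<le> ennreal (exp (-l * \<epsilon>)) * (\<integral>\<^sup>+\<omega>\<in>space M. exp (l * (F \<omega> - expectation F)) \<partial>M)"
    by (intro Chernoff_ineq_nn_integral_ge l) auto
  also have "(\<integral>\<^sup>+\<omega>\<in>space M. exp (l * (F \<omega> - expectation F)) \<partial>M)
      = (\<integral>\<^sup>+\<omega>. exp (l * (F \<omega> - expectation F)) \<partial>M)"
    by (intro nn_integral_cong) simp
  also have "ennreal (exp (-l * \<epsilon>)) * \<dots> \<le> ennreal (exp (-l * \<epsilon>)) * ennreal (exp (l\<^sup>2 * d / 8))"
    by (intro mult_left_mono mgf) auto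
  also have "\<dots> = ennreal (exp (- 2 * \<epsilon>\<^sup>2 / d))"
    using c by (simp add: l_def d_def field_simps power2_eq_square flip: ennreal_mult exp_add)
  finally show ?thesis
    by (simp add: d_def)
qed

section \<open>Second moments of sums and mean absolute values\<close>

text \<open>When the square is expanded, products of distinct variables have mean zero by
  independence and centring, so only the diagonal survives.\<close>

lemma (in prob_space) expectation_square_sum_indep:
  fixes Y :: "'i \<Rightarrow> 'a \<Rightarrow> real"
  assumes I: "finite I" and indep: "indep_vars (\<lambda>_. borel) Y I"
    and sq: "\<And>i. i \<in> I \<Longrightarrow> integrable M (\<lambda>\<omega>. (Y i \<omega>)\<^sup>2)"
    and mean: "\<And>i. i \<in> I \<Longrightarrow> expectation (Y i) = 0"
  shows "integrable M (\<lambda>\<omega>. (\<Sum>i\<in>I. Y i \<omega>)\<^sup>2)"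
    and "expectation (\<lambda>\<omega>. (\<Sum>i\<in>I. Y i \<omega>)\<^sup>2) = (\<Sum>i\<in>I. expectation (\<lambda>\<omega>. (Y i \<omega>)\<^sup>2))"
proof -
  have rv: "random_variable borel (Y i)" if "i \<in> I" for i
    using indep that by (auto simp: indep_vars_def)
  have int: "integrable M (Y i)" if "i \<in> I" for i
    by (rule square_integrable_imp_integrable[OF rv[OF that] sq[OF that]])
  have indep2: "indep_vars (\<lambda>_. borel) Y {i, k}" if "i \<in> I" "k \<in> I" for i k
    by (rule indep_vars_subset[OF indep]) (use that in auto)
  \<comment> \<open>The set \<open>{i, k}\<close> has two elements only for
    \<open>i \<noteq> k\<close>, so the diagonal is treated separately, by square
    integrability.\<close>
  have prod: "integrable M (\<lambda>\<omega>. Y i \<omega> * Y k \<omega>)" if "i \<in> I" "k \<in> I" for i k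
    using indep_vars_integrable[OF _ indep2 int, of i k] sq[of i] that
    by (cases "i = k") (auto simp: power2_eq_square)
  have E: "expectation (\<lambda>\<omega>. Y i \<omega> * Y k \<omega>) = (if i = k then expectation (\<lambda>\<omega>. (Y i \<omega>)\<^sup>2) else 0)"
    if "i \<in> I" "k \<in> I" for i k
    using indep_vars_lebesgue_integral[OF _ indep2 int, of i k] mean[of i] that
    by (cases "i = k") (auto simp: power2_eq_square)
  have eq: "(\<Sum>i\<in>I. Y i \<omega>)\<^sup>2 = (\<Sum>i\<in>I. \<Sum>k\<in>I. Y i \<omega> * Y k \<omega>)" for \<omega>
    by (simp add: power2_eq_square sum_product)
  show "integrable M (\<lambda>\<omega>. (\<Sum>i\<in>I. Y i \<omega>)\<^sup>2)"
    unfolding eq by (intro Bochner_Integration.integrable_sum prod)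
  have "expectation (\<lambda>\<omega>. (\<Sum>i\<in>I. Y i \<omega>)\<^sup>2) = (\<Sum>i\<in>I. \<Sum>k\<in>I. expectation (\<lambda>\<omega>. Y i \<omega> * Y k \<omega>))"
    unfolding eq by (simp add: Bochner_Integration.integral_sum prod)
  also have "\<dots> = (\<Sum>i\<in>I. \<Sum>k\<in>I. if i = k then expectation (\<lambda>\<omega>. (Y i \<omega>)\<^sup>2) else 0)"
    by (intro sum.cong refl E)
  also have "\<dots> = (\<Sum>i\<in>I. expectation (\<lambda>\<omega>. (Y i \<omega>)\<^sup>2))"
    using I by simp
  finally show "expectation (\<lambda>\<omega>. (\<Sum>i\<in>I. Y i \<omega>)\<^sup>2) = (\<Sum>i\<in>I. expectation (\<lambda>\<omega>. (Y i \<omega>)\<^sup>2))" .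
qed

text \<open>The variance of \<open>\<bar>Z \<omega>\<bar>\<close> is nonnegative, and the absolute
  value has the same square as \<open>Z \<omega>\<close>.\<close>

lemma (in prob_space) expectation_abs_le_sqrt:
  fixes Z :: "'a \<Rightarrow> real"
  assumes Z: "integrable M Z" "integrable M (\<lambda>\<omega>. (Z \<omega>)\<^sup>2)"
  shows "expectation (\<lambda>\<omega>. \<bar>Z \<omega>\<bar>) \<le> sqrt (expectation (\<lambda>\<omega>. (Z \<omega>)\<^sup>2))"
proof (rule real_le_rsqrt)
  show "(expectation (\<lambda>\<omega>. \<bar>Z \<omega>\<bar>))\<^sup>2 \<le> expectation (\<lambda>\<omega>. (Z \<omega>)\<^sup>2)"
    using variance_positive[of "\<lambda>\<omega>. \<bar>Z \<omega>\<bar>"] variance_eq[of "\<lambda>\<omega>. \<bar>Z \<omega>\<bar>"] Z by simp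
qed


section \<open>Summability and bounded differences of the l1 distance\<close>

lemma has_sum_of_bool_eq: "a \<in> A \<Longrightarrow> ((\<lambda>j. of_bool (a = j)) has_sum (1::real)) A"
  by (rule has_sum_finite_neutralI[where B = "{a}"]) auto

lemma has_sum_emp_freq:
  assumes "n \<ge> 1" "\<And>i. i \<in> {1..n} \<Longrightarrow> X i \<omega> \<ge> 1"
  shows "((\<lambda>j. emp_freq X n j \<omega>) has_sum 1) {1..}"
proof -
  \<comment> \<open>Stated for all subsets \<open>I\<close> of \<open>{1..n}\<close>, so that
    induction adds one sample at a time, each of total mass 1.\<close>
  have "((\<lambda>j. \<Sum>i\<in>I. of_bool (X i \<omega> = j)) has_sum real (card I)) {1..}"
    if "finite I" "I \<subseteq> {1..n}" for I
    using that
  proof (induction I rule: finite_induct)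
    case (insert i I)
    have "((\<lambda>j. of_bool (X i \<omega> = j)) has_sum (1::real)) {1..}"
      by (rule has_sum_of_bool_eq) (use insert.prems assms(2)[of i] in auto)
    from has_sum_add[OF this insert.IH] insert.prems insert.hyps show ?case
      by (simp del: sum_of_bool_eq)
  qed simp
  from has_sum_cmult_right[OF this[of "{1..n}"], of "1 / real n"] \<open>n \<ge> 1\<close> show ?thesis
    by (simp add: emp_freq_def)
qed

text \<open>Each term is dominated by \<open>emp_freq X n j \<omega> + p j\<close>, a family with
  sum 2. Summability makes the \<open>infsum\<close> in \<open>l1_dist\<close> a genuine sum and not
  the default 0; the upper bound gives the boundedness that McDiarmid's inequality asks for.\<close>

lemma
  assumes p: "distribution_on_pos p" and X: "n \<ge> 1" "\<And>i. i \<in> {1..n} \<Longrightarrow> X i \<omega> \<ge> 1"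
  shows has_sum_l1_dist: "((\<lambda>j. \<bar>emp_freq X n j \<omega> - p j\<bar>) has_sum l1_dist p X n \<omega>) {1..}"
    and l1_dist_nonneg: "0 \<le> l1_dist p X n \<omega>"
    and l1_dist_le_2: "l1_dist p X n \<omega> \<le> 2"
proof -
  have sum: "((\<lambda>j. emp_freq X n j \<omega> + p j) has_sum (1 + 1)) {1..}"
    using p by (intro has_sum_add has_sum_emp_freq X) (auto simp: distribution_on_pos_def)
  have le: "\<bar>emp_freq X n j \<omega> - p j\<bar> \<le> emp_freq X n j \<omega> + p j" if "j \<in> {1..}" for j
  proof -
    have "0 \<le> emp_freq X n j \<omega>" "0 \<le> p j"
      using p that by (auto simp: distribution_on_pos_def emp_freq_def intro: sum_nonneg)
    then show ?thesis by simp
  qed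
  have "(\<lambda>j. \<bar>emp_freq X n j \<omega> - p j\<bar>) summable_on {1..}"
    by (rule summable_on_comparison_test[OF has_sum_imp_summable[OF sum] le]) auto
  then show has_sum: "((\<lambda>j. \<bar>emp_freq X n j \<omega> - p j\<bar>) has_sum l1_dist p X n \<omega>) {1..}"
    unfolding l1_dist_def by (rule has_sum_infsum)
  then show "0 \<le> l1_dist p X n \<omega>"
    by (rule has_sum_nonneg) simp
  show "l1_dist p X n \<omega> \<le> 2"
    using has_sum_mono[OF has_sum sum le] by simp
qed

text \<open>The triangle inequality at each \<open>j\<close>. Tuples \<open>x\<close> are the points
  of the sample space here, and the samples are the coordinate projections
  \<open>\<lambda>i x. x i\<close>.\<close>

lemma l1_dist_fun_upd_le:
  fixes x :: "nat \<Rightarrow> nat"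
  assumes p: "distribution_on_pos p" and x: "\<And>i. i \<in> {1..n} \<Longrightarrow> x i \<ge> 1"
    and i: "i \<in> {1..n}" and y: "y \<ge> 1"
  shows "l1_dist p (\<lambda>i x. x i) n (x(i := y)) \<le> l1_dist p (\<lambda>i x. x i) n x + 2 / real n"
proof -
  have n: "n \<ge> 1" using i by auto
  \<comment> \<open>Sample \<open>i\<close> carries its mass \<open>1 / real n\<close> from
    \<open>x i\<close> to \<open>y\<close>; if the two coincide, the indicators cancel.\<close>
  have upd: "emp_freq (\<lambda>i x. x i) n j (x(i := y))
      = emp_freq (\<lambda>i x. x i) n j x + 1 / real n * (of_bool (y = j) - of_bool (x i = j))" for j
  proof -
    have "(\<Sum>k=1..n. of_bool ((x(i := y)) k = j) :: real)
        = (\<Sum>k=1..n. of_bool (x k = j) + (if k = i then of_bool (y = j) - of_bool (x i = j) else 0))"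
      by (intro sum.cong) auto
    also have "\<dots> = (\<Sum>k=1..n. of_bool (x k = j)) + (of_bool (y = j) - of_bool (x i = j))"
      using i by (simp add: sum.distrib)
    finally show ?thesis
      unfolding emp_freq_def by (simp only: distrib_left)
  qed
  \<comment> \<open>Both indicators have sum 1 over the positive integers, whence the 2 in
    \<open>2 / real n\<close>.\<close>
  have sum: "((\<lambda>j. \<bar>emp_freq (\<lambda>i x. x i) n j x - p j\<bar> + 1 / real n * (of_bool (y = j) + of_bool (x i = j)))
          has_sum (l1_dist p (\<lambda>i x. x i) n x + 1 / real n * (1 + 1))) {1..}"
    using x i y n by (intro has_sum_add has_sum_cmult_right has_sum_of_bool_eq has_sum_l1_dist[OF p]) auto
  have sum_upd: "((\<lambda>j. \<bar>emp_freq (\<lambda>i x. x i) n j (x(i := y)) - p j\<bar>)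
          has_sum l1_dist p (\<lambda>i x. x i) n (x(i := y))) {1..}"
    using x y n by (intro has_sum_l1_dist[OF p]) auto
  have "\<bar>emp_freq (\<lambda>i x. x i) n j (x(i := y)) - p j\<bar>
      \<le> \<bar>emp_freq (\<lambda>i x. x i) n j x - p j\<bar> + 1 / real n * (of_bool (y = j) + of_bool (x i = j))" for j
  proof -
    have "\<bar>1 / real n * (of_bool (y = j) - of_bool (x i = j))\<bar>
        \<le> 1 / real n * (of_bool (y = j) + of_bool (x i = j))"
      by (simp add: of_bool_def)
    then show ?thesis
      unfolding upd by linarith
  qed
  then have "l1_dist p (\<lambda>i x. x i) n (x(i := y)) \<le> l1_dist p (\<lambda>i x. x i) n x + 1 / real n * (1 + 1)"
    by (rule has_sum_mono[OF sum_upd sum])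
  then show ?thesis by simp
qed

text \<open>The other direction is the one-sided bound for the update that restores
  \<open>x i\<close>.\<close>

lemma l1_dist_fun_upd:
  fixes x :: "nat \<Rightarrow> nat"
  assumes p: "distribution_on_pos p" and x: "\<And>i. i \<in> {1..n} \<Longrightarrow> x i \<ge> 1"
    and i: "i \<in> {1..n}" and y: "y \<ge> 1"
  shows "\<bar>l1_dist p (\<lambda>i x. x i) n (x(i := y)) - l1_dist p (\<lambda>i x. x i) n x\<bar> \<le> 2 / real n"
proof -
  have "l1_dist p (\<lambda>i x. x i) n ((x(i := y))(i := x i)) \<le> l1_dist p (\<lambda>i x. x i) n (x(i := y)) + 2 / real n"
    using x y by (intro l1_dist_fun_upd_le[OF p _ i x[OF i]]) auto
  moreover have "l1_dist p (\<lambda>i x. x i) n (x(i := y)) \<le> l1_dist p (\<lambda>i x. x i) n x + 2 / real n"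
    by (rule l1_dist_fun_upd_le[OF p x i y])
  ultimately show ?thesis
    by (simp add: abs_le_iff)
qed

section \<open>The mean of the l1 distance\<close>

text \<open>The deviation \<open>emp_freq X n j \<omega> - p j\<close> is the average of
  \<open>n\<close> independent centred indicators, each of variance at most
  \<open>p j\<close>.\<close>

lemma (in prob_space) expectation_abs_emp_freq_le:
  fixes X :: "nat \<Rightarrow> 'a \<Rightarrow> nat"
  assumes p: "distribution_on_pos p" and n: "n \<ge> 1" and j: "j \<ge> 1"
    and indep: "indep_vars (\<lambda>_. count_space {1..}) X {1..n}"
    and X: "\<And>i. i \<in> {1..n} \<Longrightarrow> distributed M (count_space {1..}) (X i) (\<lambda>j. ennreal (p j))"
  shows "integrable M (\<lambda>\<omega>. \<bar>emp_freq X n j \<omega> - p j\<bar>)" (is ?int)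
    and "expectation (\<lambda>\<omega>. \<bar>emp_freq X n j \<omega> - p j\<bar>) \<le> sqrt (p j) / sqrt n" (is ?le)
proof -
  have p_nonneg: "0 \<le> p k" if "k \<ge> 1" for k
    using p that by (auto simp: distribution_on_pos_def)
  define Y where "Y i \<omega> = of_bool (X i \<omega> = j) - p j" for i \<omega>
  have rv [measurable]: "X i \<in> measurable M (count_space {1..})" if "i \<in> {1..n}" for i
    using indep that by (auto simp: indep_vars_def)
  have ind_meas: "(\<lambda>\<omega>. of_bool (X i \<omega> = j) :: real) \<in> borel_measurable M" if "i \<in> {1..n}" for i
    by (rule measurable_compose[OF rv[OF that]]) simp
  have ind: "integrable M (\<lambda>\<omega>. of_bool (X i \<omega> = j) :: real)" if "i \<in> {1..n}" for i
    by (rule integrable_const_bound[where B = 1]) (use ind_meas[OF that] in auto)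
  have E_ind: "expectation (\<lambda>\<omega>. of_bool (X i \<omega> = j)) = p j" if "i \<in> {1..n}" for i
  proof -
    \<comment> \<open>The law of \<open>X i\<close> has density \<open>p\<close> with respect to
      counting measure, so the expectation is a sum in which only the term \<open>k = j\<close> can
      be nonzero.\<close>
    have "expectation (\<lambda>\<omega>. of_bool (X i \<omega> = j)) = (\<integral>k. p k * of_bool (k = j) \<partial>count_space {1..})"
      by (rule distributed_integral[OF X[OF that], symmetric]) (auto intro: p_nonneg)
    also have "\<dots> = (\<Sum>k | k \<in> {1..} \<and> p k * of_bool (k = j) \<noteq> 0. p k * of_bool (k = j))"
      by (rule lebesgue_integral_count_space_finite_support)
         (rule finite_subset[of _ "{j}"], auto)
    also have "\<dots> = (\<Sum>k\<in>{j}. p k * of_bool (k = j))"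
      by (rule sum.mono_neutral_left) (use j in auto)
    finally show ?thesis by simp
  qed
  \<comment> \<open>An indicator equals its own square, so the square of \<open>Y i \<omega>\<close>
    is affine in it and \<open>E_ind\<close> yields its mean.\<close>
  have sq: "(Y i \<omega>)\<^sup>2 = (1 - 2 * p j) * of_bool (X i \<omega> = j) + (p j)\<^sup>2" for i \<omega>
    by (simp add: Y_def power2_eq_square algebra_simps)
  have Y_sq: "integrable M (\<lambda>\<omega>. (Y i \<omega>)\<^sup>2)" if "i \<in> {1..n}" for i
    unfolding sq using ind[OF that] by auto
  have E_sq: "expectation (\<lambda>\<omega>. (Y i \<omega>)\<^sup>2) \<le> p j" if "i \<in> {1..n}" for i
  proof -
    have "expectation (\<lambda>\<omega>. (Y i \<omega>)\<^sup>2) = (1 - 2 * p j) * p j + (p j)\<^sup>2"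
      unfolding sq using ind[OF that] by (simp add: E_ind[OF that] prob_space)
    also have "\<dots> = p j - (p j)\<^sup>2"
      by (simp add: power2_eq_square algebra_simps)
    finally show ?thesis by simp
  qed
  have Y_mean: "expectation (Y i) = 0" if "i \<in> {1..n}" for i
    unfolding Y_def using ind[OF that] by (simp add: E_ind[OF that] prob_space)
  have Y_indep: "indep_vars (\<lambda>_. borel) Y {1..n}"
    unfolding Y_def by (rule indep_vars_compose2[OF indep]) simp
  define Z where "Z \<omega> = emp_freq X n j \<omega> - p j" for \<omega>
  have Z: "Z \<omega> = 1 / real n * (\<Sum>i=1..n. Y i \<omega>)" for \<omega>
    using n by (simp add: Z_def emp_freq_def Y_def sum_subtractf field_simps)
  have Z_sq: "(Z \<omega>)\<^sup>2 = (1 / real n)\<^sup>2 * (\<Sum>i=1..n. Y i \<omega>)\<^sup>2" for \<omega>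
    unfolding Z by (rule power_mult_distrib)
  have int_Z: "integrable M Z"
    unfolding Z_def emp_freq_def
    by (intro Bochner_Integration.integrable_diff integrable_mult_right
        Bochner_Integration.integrable_sum ind integrable_const)
  then show ?int
    unfolding Z_def by (rule integrable_abs)
  have int_Z_sq: "integrable M (\<lambda>\<omega>. (Z \<omega>)\<^sup>2)"
    unfolding Z_sq
    by (intro integrable_mult_right expectation_square_sum_indep(1) Y_indep Y_sq Y_mean) auto
  have "expectation (\<lambda>\<omega>. (Z \<omega>)\<^sup>2) = (1 / real n)\<^sup>2 * (\<Sum>i=1..n. expectation (\<lambda>\<omega>. (Y i \<omega>)\<^sup>2))"
    unfolding Z_sq using expectation_square_sum_indep[OF _ Y_indep Y_sq Y_mean] by simp
  also have "\<dots> \<le> (1 / real n)\<^sup>2 * (\<Sum>i=1..n. p j)"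
    by (intro mult_left_mono sum_mono E_sq) auto
  also have "\<dots> = p j / n"
    using n by (simp add: power2_eq_square)
  finally have "sqrt (expectation (\<lambda>\<omega>. (Z \<omega>)\<^sup>2)) \<le> sqrt (p j) / sqrt n"
    by (simp flip: real_sqrt_divide)
  with expectation_abs_le_sqrt[OF int_Z int_Z_sq] show ?le
    unfolding Z_def by linarith
qed

text \<open>Moves sums over the positive integers to series indexed from 0, the form required for
  monotone convergence.\<close>

lemma has_sum_pos_nat_imp_sums:
  "(f has_sum s) {1::nat..} \<Longrightarrow> (\<lambda>k. f (Suc k)) sums s"
proof (rule has_sum_imp_sums)
  assume "(f has_sum s) {1..}"
  moreover have "bij_betw Suc UNIV {1..}"
    by (rule bij_betwI[where g = "\<lambda>k. k - 1"]) auto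
  ultimately show "((\<lambda>k. f (Suc k)) has_sum s) UNIV"
    by (simp only: has_sum_reindex_bij_betw)
qed

text \<open>A finite product of counting spaces on a countable set is again a counting space, where
  every real function is measurable.\<close>

lemma measurable_l1_dist:
  "l1_dist p (\<lambda>i x. x i) n \<in> borel_measurable (PiM {1..n} (\<lambda>_. count_space {1..}))"
  by (subst count_space_PiM_finite) auto

text \<open>Monotone convergence exchanges the expectation with the sum over \<open>j\<close>. The
  bounds \<open>sqrt (p j) / sqrt n\<close> on the single terms then add up, by
  \<open>nu_finite p\<close>, to \<open>nu p / sqrt n\<close>.\<close>

lemma (in prob_space) expectation_l1_dist_le:
  fixes X :: "nat \<Rightarrow> 'a \<Rightarrow> nat"
  assumes p: "distribution_on_pos p" and nu: "nu_finite p" and n: "n \<ge> 1"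
    and indep: "indep_vars (\<lambda>_. count_space {1..}) X {1..n}"
    and X: "\<And>i. i \<in> {1..n} \<Longrightarrow> distributed M (count_space {1..}) (X i) (\<lambda>j. ennreal (p j))"
  shows "expectation (l1_dist p X n) \<le> nu p / sqrt n"
proof -
  have rv: "X i \<in> measurable M (count_space {1..})" if "i \<in> {1..n}" for i
    using indep that by (auto simp: indep_vars_def)
  have X_pos: "X i \<omega> \<ge> 1" if "i \<in> {1..n}" "\<omega> \<in> space M" for i \<omega>
    using measurable_space[OF rv] that by force
  have p_nonneg: "0 \<le> p (Suc k)" for k
    using p by (simp add: distribution_on_pos_def)
  define Z where "Z k \<omega> = \<bar>emp_freq X n (Suc k) \<omega> - p (Suc k)\<bar>" for k \<omega>
  have Z_nonneg: "0 \<le> Z k \<omega>" for k \<omega>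
    by (simp add: Z_def)
  have Z_sums: "(\<lambda>k. Z k \<omega>) sums l1_dist p X n \<omega>" if "\<omega> \<in> space M" for \<omega>
    unfolding Z_def by (intro has_sum_pos_nat_imp_sums has_sum_l1_dist p n X_pos) (use that in auto)
  have nu_sums: "(\<lambda>k. sqrt (p (Suc k)) / sqrt n) sums (nu p / sqrt n)"
    using nu unfolding nu_finite_def nu_def
    by (intro sums_divide has_sum_pos_nat_imp_sums has_sum_infsum)
  \<comment> \<open>The return from the nonnegative integral to \<open>expectation\<close> at the
    end calls for a nonnegative bound.\<close>
  have nu_nonneg: "0 \<le> nu p / sqrt n"
    by (rule sums_le[OF _ sums_zero nu_sums]) (simp add: p_nonneg)
  have Z_int: "integrable M (Z k)" "expectation (Z k) \<le> sqrt (p (Suc k)) / sqrt n" for k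
    unfolding Z_def using expectation_abs_emp_freq_le[OF p n _ indep X, of "Suc k"] by auto
  have "(\<integral>\<^sup>+\<omega>. ennreal (l1_dist p X n \<omega>) \<partial>M) = (\<integral>\<^sup>+\<omega>. (\<Sum>k. ennreal (Z k \<omega>)) \<partial>M)"
  proof (rule nn_integral_cong)
    fix \<omega> assume "\<omega> \<in> space M"
    from Z_sums[OF this] show "ennreal (l1_dist p X n \<omega>) = (\<Sum>k. ennreal (Z k \<omega>))"
      by (subst suminf_ennreal2) (auto simp: sums_iff Z_def)
  qed
  also have "\<dots> = (\<Sum>k. \<integral>\<^sup>+\<omega>. ennreal (Z k \<omega>) \<partial>M)"
    by (rule nn_integral_suminf) (use Z_int(1) in auto)
  also have "\<dots> = (\<Sum>k. ennreal (expectation (Z k)))"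
    by (intro suminf_cong nn_integral_eq_integral) (use Z_int(1) Z_nonneg in auto)
  also have "\<dots> \<le> (\<Sum>k. ennreal (sqrt (p (Suc k)) / sqrt n))"
    by (intro suminf_le ennreal_leI) (use Z_int(2) in auto)
  also have "\<dots> = ennreal (nu p / sqrt n)"
    using nu_sums by (subst suminf_ennreal2) (auto simp: sums_iff p_nonneg)
  finally have "(\<integral>\<^sup>+\<omega>. ennreal (l1_dist p X n \<omega>) \<partial>M) \<le> ennreal (nu p / sqrt n)" .
  then show ?thesis
    using nu_nonneg by (rule integral_real_bounded[rotated])
qed

section \<open>The tail bound for the l1 distance\<close>

theorem theorem2p2:
  fixes p :: "nat \<Rightarrow> real" and M :: "'a measure" and X :: "nat \<Rightarrow> 'a \<Rightarrow> nat"
    and n :: nat and \<epsilon> :: real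
  assumes "distribution_on_pos p" and "nu_finite p"
    and "prob_space M" and "n \<ge> 1"
    and "prob_space.indep_vars M (\<lambda>_. count_space {1..}) X {1..n}"
    and "\<forall>i\<in>{1..n}. distributed M (count_space {1..}) (X i) (\<lambda>j. ennreal (p j))"
    and "\<epsilon> > 0"
  shows "measure M {\<omega> \<in> space M. l1_dist p X n \<omega> > real n powr (- 1 / 2) * nu p + \<epsilon>}
           \<le> exp (- (real n * \<epsilon>\<^sup>2 / 2))"
proof -
  interpret prob_space M by fact
  let ?N = "\<lambda>_::nat. count_space {1::nat..}"
  let ?J = "l1_dist p (\<lambda>i x. x i) n"
  have n: "n > 0" using \<open>n \<ge> 1\<close> by simp
  \<comment> \<open>The distance reads only the samples with index in \<open>{1..n}\<close>, so
    restricting the tuple to them changes nothing.\<close>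
  have tuple: "?J (\<lambda>i\<in>{1..n}. X i \<omega>) = l1_dist p X n \<omega>" for \<omega>
    by (simp add: l1_dist_def emp_freq_def)
  have rv: "X i \<in> measurable M (count_space {1..})" if "i \<in> {1..n}" for i
    using assms(5) that by (auto simp: indep_vars_def)
  have [measurable]: "(\<lambda>\<omega>. l1_dist p X n \<omega>) \<in> borel_measurable M"
    unfolding tuple[symmetric]
    by (intro measurable_compose[OF _ measurable_l1_dist] measurable_restrict rv)
  \<comment> \<open>This sum turns McDiarmid's exponent into
    \<open>- 2 * \<epsilon>\<^sup>2 / (4 / n)\<close>, which is
    \<open>- (real n * \<epsilon>\<^sup>2 / 2)\<close>.\<close>
  have c: "(\<Sum>i\<in>{1..n}. (2 / real n)\<^sup>2) = 4 / n"
    using n by (simp add: power2_eq_square)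
  have "real n powr (- 1 / 2) * nu p = nu p / sqrt n"
    using powr_minus[of "real n" "1 / 2"] by (simp add: powr_half_sqrt field_simps)
  \<comment> \<open>Replacing the mean by an upper bound raises the threshold, so the event can only
    shrink.\<close>
  then have "{\<omega> \<in> space M. l1_dist p X n \<omega> > real n powr (- 1 / 2) * nu p + \<epsilon>}
      \<subseteq> {\<omega> \<in> space M. l1_dist p X n \<omega> \<ge> expectation (l1_dist p X n) + \<epsilon>}"
    using expectation_l1_dist_le[of p n X] assms by auto
  then have "prob {\<omega> \<in> space M. l1_dist p X n \<omega> > real n powr (- 1 / 2) * nu p + \<epsilon>}
      \<le> prob {\<omega> \<in> space M. l1_dist p X n \<omega> \<ge> expectation (l1_dist p X n) + \<epsilon>}"
    by (rule finite_measure_mono) measurable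
  also have "\<dots> \<le> exp (- 2 * \<epsilon>\<^sup>2 / (\<Sum>i\<in>{1..n}. (2 / real n)\<^sup>2))"
  proof (rule McDiarmid_ineq_ge[where f = ?J and N = ?N and X = X and I = "{1..n}"
        and c = "\<lambda>_. 2 / real n" and B = 2, unfolded tuple])
    fix x assume x: "x \<in> space (PiM {1..n} ?N)"
    then have x_pos: "x i \<ge> 1" if "i \<in> {1..n}" for i
      using that by (auto simp: space_PiM PiE_def Pi_def)
    show "\<bar>?J x\<bar> \<le> 2"
      using l1_dist_nonneg[of p n "\<lambda>i x. x i" x] l1_dist_le_2[of p n "\<lambda>i x. x i" x] x_pos assms by simp
    show "\<bar>?J (x(i := y)) - ?J x\<bar> \<le> 2 / real n" if "i \<in> {1..n}" "y \<in> space (?N i)" for i y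
      using that by (intro l1_dist_fun_upd assms x_pos) auto
  next
    show "(\<Sum>i\<in>{1..n}. (2 / real n)\<^sup>2) > 0"
      unfolding c using n by simp
    show "{1..n} \<noteq> {}"
      using n by simp
  qed (rule finite_atLeastAtMost assms measurable_l1_dist)+
  also have "- 2 * \<epsilon>\<^sup>2 / (\<Sum>i\<in>{1..n}. (2 / real n)\<^sup>2) = - (real n * \<epsilon>\<^sup>2 / 2)"
    unfolding c using n by simp
  finally show ?thesis .
qed

end
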